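(* For each real $c_{\rm ind}$ with $0 < c_{\rm ind} \leq 1/2$ set $$ k(c_{\rm ind}) = \begin{cases} \left(1+\frac{1}{2c_{\rm ind}}\right)^{c_{\rm ind}} & \text{if } 1/(2c_{\rm ind}) \text{ is an integer},\\ \left(1+\left\lfloor\frac{1}{2c_{\rm ind}}\right\rfloor\right)^{c_{\rm ind}\left\lceil\frac{1}{2c_{\rm ind}}\right\rceil-1/2} \left(1+\left\lceil\frac{1}{2c_{\rm ind}}\right\rceil\right)^{1/2-c_{\rm ind}\left\lfloor\frac{1}{2c_{\rm ind}}\right\rfloor} & \text{otherwise.} \end{cases} $$ Then for each such $c_{\rm ind}$ the following two statements hold. (UB1) Let $N \subseteq \mathbb{N}$ be an infinite set, and let $\{(n,d_n,\alpha_n): n \in N\}$ be a sequence of triples of positive integers with (P1) $d_n \rightarrow \infty$ as $n \rightarrow \infty$ and (P2) $\alpha_n/n \rightarrow c_{\rm ind}$ as $n \rightarrow \infty$. If $(G_n)_{n \in N}$ is a sequence of graphs with $G_n$ an $(n,d_n,\alpha_n)$-graph for each $n \in N$, then $$ i(G_n) \leq k(c_{\rm ind})^{n(1+o(1))}, $$ where $o(1) \rightarrow 0$ as $n \rightarrow \infty$. (LB1) There are an infinite set $N \subseteq \mathbb{N}$, a sequence of triples of positive integers $\{(n,d_n,\alpha_n): n \in N\}$ satisfying (P1) $d_n \to \infty$ as $n\to\infty$, (P2) $\alpha_n/n \to c_{\rm ind}$ as $n \to\infty$, and (P3) $\limsup_{n \rightarrow \infty} d_n/n \leq 1/2$, and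 a sequence of graphs $(G_n)_{n \in N}$ with $G_n$ an $(n,d_n,\alpha_n)$-graph for each $n \in N$, such that $$ i(G_n) \geq k(c_{\rm ind})^{n(1+o(1))}, $$ where $o(1) \rightarrow 0$ as $n \rightarrow \infty$.
   Context: Graphs are finite and simple. $i(G)$ denotes the number of independent sets (sets of mutually non-adjacent vertices, including the empty set) of a graph $G$. An $(n,d,\alpha)$-graph is a $d$-regular graph on $n$ vertices whose largest independent set has size at most $\alpha$. All limits are taken along $n \in N$. *)

theory Defs
  imports "HOL-Analysis.Analysis" "HOL-Library.Ramsey"
begin

(* A finite simple graph is given by its vertex set V and its edge set E, a set of
   two-element subsets of V; "nsets" and "indep" are taken from HOL-Library.Ramsey. *)

definition simple_graph :: "'a set \<Rightarrow> 'a set set \<Rightarrow> bool" where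
  "simple_graph V E \<longleftrightarrow> finite V \<and> E \<subseteq> nsets V 2"

definition indep_sets_of :: "'a set \<Rightarrow> 'a set set \<Rightarrow> 'a set set" where
  "indep_sets_of V E = {I. I \<subseteq> V \<and> indep I E}"

definition num_indep_sets :: "'a set \<Rightarrow> 'a set set \<Rightarrow> nat" where
  "num_indep_sets V E = card (indep_sets_of V E)"

definition independence_number :: "'a set \<Rightarrow> 'a set set \<Rightarrow> nat" where
  "independence_number V E = Max (card ` indep_sets_of V E)"

definition regular_graph :: "nat \<Rightarrow> 'a set \<Rightarrow> 'a set set \<Rightarrow> bool" where
  "regular_graph d V E \<longleftrightarrow> (\<forall>v\<in>V. card {w \<in> V. {v, w} \<in> E} = d)"

definition nda_graph :: "nat \<Rightarrow> nat \<Rightarrow> nat \<Rightarrow> 'a set \<Rightarrow> 'a set set \<Rightarrow> bool" where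
  "nda_graph n d \<alpha> V E \<longleftrightarrow>
     simple_graph V E \<and> card V = n \<and> regular_graph d V E \<and> independence_number V E \<le> \<alpha>"

(* The filter of "n tends to infinity through N". *)
abbreviation along :: "nat set \<Rightarrow> nat filter" where
  "along N \<equiv> inf sequentially (principal N)"

definition k_ind :: "real \<Rightarrow> real" where
  "k_ind c =
     (if 1 / (2 * c) \<in> \<int> then (1 + 1 / (2 * c)) powr c
      else (1 + of_int \<lfloor>1 / (2 * c)\<rfloor>) powr (c * of_int \<lceil>1 / (2 * c)\<rceil> - 1 / 2)
         * (1 + of_int \<lceil>1 / (2 * c)\<rceil>) powr (1 / 2 - c * of_int \<lfloor>1 / (2 * c)\<rfloor>))"

end

theory Submission
  imports Defs "HOL-Real_Asymp.Real_Asymp"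
begin

text \<open>
  Put \<open>s = \<lfloor>1 / (2 * c)\<rfloor>\<close>. Both cases of the definition of \<open>k_ind c\<close> are instances of the single
  formula \<open>(1 + s) powr (c * (s + 1) - 1 / 2) * (2 + s) powr (1 / 2 - c * s)\<close>. If \<open>n/2\<close> vertices are
  split into \<open>c n\<close> disjoint cliques whose orders are as equal as possible, then the orders are \<open>s\<close>
  and \<open>s + 1\<close>, they occur \<open>(c * (s + 1) - 1 / 2) n\<close> and \<open>(1 / 2 - c * s) n\<close> times, and a clique of
  order \<open>t\<close> has \<open>1 + t\<close> independent sets. So \<open>k_ind c ^ n\<close> is the number of independent sets of
  such a union of cliques on half of the vertices.

  For the upper bound, a small set \<open>T\<close> of at most \<open>n / \<phi>\<close> vertices of an independent set \<open>I\<close> of a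
  \<open>d\<close>-regular graph is enough to confine \<open>I\<close> to a container that depends on \<open>T\<close> only
  (\<open>exists_fingerprint\<close>) and that has at most \<open>n d / (2 d - \<phi>)\<close> vertices (\<open>card_container_le\<close>).
  With \<open>\<phi> = sqrt d \<longrightarrow> \<infinity>\<close> there are only \<open>exp (o(n))\<close> choices of \<open>T\<close> (\<open>card_small_subsets_le\<close>) and
  the containers have \<open>n/2 + o(n)\<close> vertices. Inside a container the independence number is still at
  most \<open>c n + o(n)\<close>, and a form of Zykov's theorem (\<open>zykov_bound\<close>) says that
  a graph with \<open>m\<close> vertices and independence number at most \<open>a\<close> has no more independent sets than a
  union of \<open>a\<close> nearly equal cliques. The factors multiply to \<open>k_ind c ^ (n (1 + o(1)))\<close>.

  For the lower bound, take two copies of the extremal union of cliques on \<open>n/2\<close> vertices each and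
  join them completely. The join adds no large independent set, so the independence number stays
  at most \<open>c n\<close>. The vertices of the larger cliques have one neighbour too many; deleting a perfect matching
  between the large cliques of the two copies makes the graph regular of degree \<open>n/2 + s - 1\<close>, at
  the cost of creating only independent sets with two elements.
\<close>

section \<open>Independent sets and vertex deletion\<close>

definition nbrs :: "'a set \<Rightarrow> 'a set set \<Rightarrow> 'a \<Rightarrow> 'a set" where
  "nbrs V E v = {w \<in> V. w \<noteq> v \<and> {v, w} \<in> E}"

lemma finite_nbrs [simp]: "finite V \<Longrightarrow> finite (nbrs V E v)"
  by (simp add: nbrs_def)

lemma nbrs_sym: "v \<in> V \<Longrightarrow> w \<in> V \<Longrightarrow> w \<in> nbrs V E v \<longleftrightarrow> v \<in> nbrs V E w"
  by (auto simp: nbrs_def insert_commute)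

lemma finite_indep_sets_of [simp]: "finite V \<Longrightarrow> finite (indep_sets_of V E)"
  by (rule finite_subset[of _ "Pow V"]) (auto simp: indep_sets_of_def)

lemma indep_sets_of_mono: "W \<subseteq> V \<Longrightarrow> indep_sets_of W E \<subseteq> indep_sets_of V E"
  by (auto simp: indep_sets_of_def)

lemma empty_in_indep_sets_of [simp]: "{} \<in> indep_sets_of V E"
  by (simp add: indep_sets_of_def)

lemma indep_sets_of_nonempty [simp]: "indep_sets_of V E \<noteq> {}"
  using empty_in_indep_sets_of by fast

lemma insert_in_indep_sets_of:
  assumes "v \<in> V" "J \<in> indep_sets_of (V - insert v (nbrs V E v)) E"
  shows "insert v J \<in> indep_sets_of V E"
  using assms by (auto simp: indep_sets_of_def indep_def nbrs_def insert_commute subset_iff)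

lemma num_indep_sets_split:
  assumes "finite V" "v \<in> V"
  shows "num_indep_sets V E
       = num_indep_sets (V - {v}) E + num_indep_sets (V - insert v (nbrs V E v)) E"
proof -
  let ?A = "indep_sets_of (V - {v}) E"
  let ?B = "indep_sets_of (V - insert v (nbrs V E v)) E"
  have "indep_sets_of V E = ?A \<union> insert v ` ?B"
  proof (intro equalityI subsetI)
    fix I assume I: "I \<in> indep_sets_of V E"
    show "I \<in> ?A \<union> insert v ` ?B"
    proof (cases "v \<in> I")
      case True
      then have "I - {v} \<in> ?B"
        using I by (auto simp: indep_sets_of_def indep_def nbrs_def)
      with True show ?thesis
        by (metis UnI2 image_eqI insert_Diff)
    next
      case False
      then show ?thesis using I by (auto simp: indep_sets_of_def)
    qed
  next
    fix I assume "I \<in> ?A \<union> insert v ` ?B"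
    then show "I \<in> indep_sets_of V E"
      using insert_in_indep_sets_of[OF assms(2)] indep_sets_of_mono[of "V - {v}" V] by blast
  qed
  moreover have "?A \<inter> insert v ` ?B = {}"
    by (auto simp: indep_sets_of_def)
  moreover have "inj_on (insert v) ?B"
    by (rule inj_onI) (auto simp: indep_sets_of_def)
  ultimately show ?thesis
    using assms(1) by (simp add: num_indep_sets_def card_Un_disjoint card_image)
qed

text \<open>
  The greedy bound: choosing a vertex costs at most \<open>s\<close> vertices, itself and its neighbours.
\<close>
lemma exists_large_indep_set:
  assumes "finite V" "\<And>v. v \<in> V \<Longrightarrow> card (nbrs V E v) < s"
  shows "\<exists>I \<in> indep_sets_of V E. card V \<le> s * card I"
  using assms
proof (induction V rule: finite_psubset_induct)
  case (psubset V)
  show ?case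
  proof (cases "V = {}")
    case False
    then obtain v where v: "v \<in> V" by blast
    let ?W = "V - insert v (nbrs V E v)"
    have "card (nbrs ?W E w) < s" if "w \<in> ?W" for w
    proof -
      have "card (nbrs ?W E w) \<le> card (nbrs V E w)"
        using psubset.hyps(1) by (intro card_mono) (auto simp: nbrs_def)
      with psubset.prems[of w] that show ?thesis by auto
    qed
    moreover have "?W \<subset> V" using v by auto
    ultimately obtain J where J: "J \<in> indep_sets_of ?W E" "card ?W \<le> s * card J"
      using psubset.IH by meson
    have "finite J" "v \<notin> J"
      using J(1) psubset.hyps(1) by (auto simp: indep_sets_of_def intro: finite_subset)
    moreover have "card V \<le> card ?W + card (insert v (nbrs V E v))"
      using diff_card_le_card_Diff[of "insert v (nbrs V E v)" V] psubset.hyps(1) by simp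
    moreover have "card (insert v (nbrs V E v)) \<le> s"
      using psubset.prems[OF v] psubset.hyps(1) by (simp add: card_insert_if)
    ultimately have "card V \<le> s * card (insert v J)" using J(2) by simp
    with insert_in_indep_sets_of[OF v J(1)] show ?thesis by blast
  next
    case True
    then show ?thesis using empty_in_indep_sets_of[of V E] by (metis card.empty le0)
  qed
qed

section \<open>Zykov's bound on the number of independent sets\<close>

text \<open>
  A disjoint union of \<open>a\<close> cliques of orders \<open>s\<close> and \<open>s + 1\<close> with \<open>m\<close> vertices has \<open>(s + 1) a - m\<close>
  cliques of the first kind and \<open>m - s a\<close> of the second, hence
  \<open>(1 + s) ^ ((s + 1) a - m) * (2 + s) ^ (m - s a)\<close> independent sets. Collecting the powers of \<open>a\<close>
  and \<open>m\<close> gives \<open>zykov_coeff s ^ a * zykov_base s ^ m\<close>, which also makes sense when \<open>m\<close> is not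
  between \<open>s a\<close> and \<open>(s + 1) a\<close>. As a function of \<open>m\<close> its logarithm is an affine function that
  extends one segment of the concave, piecewise affine function \<open>m \<mapsto> a g (m / a)\<close>, where \<open>g\<close>
  interpolates \<open>ln (1 + t)\<close> between integers \<open>t\<close>.
\<close>
definition zykov_base :: "nat \<Rightarrow> real" where
  "zykov_base s = (2 + real s) / (1 + real s)"

definition zykov_coeff :: "nat \<Rightarrow> real" where
  "zykov_coeff s = (1 + real s) / zykov_base s ^ s"

lemma zykov_base_gt_1: "zykov_base s > 1"
  by (simp add: zykov_base_def field_simps)

lemma zykov_coeff_pos: "zykov_coeff s > 0"
  using zykov_base_gt_1[of s] by (simp add: zykov_coeff_def)

text \<open>
  The segments for \<open>s\<close> and \<open>s + 1\<close> meet at \<open>m = (s + 1) a\<close>, where both bounds equal \<open>(2 + s) ^ a\<close>.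
  To the left of that point the bound for \<open>s\<close> is the smaller one, because its logarithm
  has the larger slope \<open>ln (zykov_base s)\<close>.
\<close>
lemma zykov_bound_mono:
  assumes "m \<le> Suc s * a"
  shows "zykov_coeff s ^ a * zykov_base s ^ m \<le> zykov_coeff (Suc s) ^ a * zykov_base (Suc s) ^ m"
proof -
  have pos: "0 < zykov_base s" "0 < zykov_base (Suc s)"
    using zykov_base_gt_1[of s] zykov_base_gt_1[of "Suc s"] by linarith+
  have eq1: "zykov_coeff s * zykov_base s ^ Suc s = 2 + real s"
    using pos by (simp add: zykov_coeff_def) (simp add: zykov_base_def)
  have eq2: "zykov_coeff (Suc s) * zykov_base (Suc s) ^ Suc s = 2 + real s"
    using pos by (simp add: zykov_coeff_def)
  define r where "r = Suc s * a - m"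
  have mr: "m + r = Suc s * a" using assms by (simp add: r_def)
  have full: "zykov_coeff t ^ a * zykov_base t ^ m * zykov_base t ^ r
      = (zykov_coeff t * zykov_base t ^ Suc s) ^ a" for t
    by (simp only: mult.assoc power_add[symmetric] mr power_mult power_mult_distrib)
  have "zykov_base (Suc s) \<le> zykov_base s"
    by (simp add: zykov_base_def field_simps)
  then have "zykov_base (Suc s) ^ r \<le> zykov_base s ^ r"
    using pos by (intro power_mono) auto
  then have "zykov_coeff s ^ a * zykov_base s ^ m * zykov_base (Suc s) ^ r
      \<le> zykov_coeff s ^ a * zykov_base s ^ m * zykov_base s ^ r"
    using pos zykov_coeff_pos[of s] by (intro mult_left_mono) auto
  also have "\<dots> = zykov_coeff (Suc s) ^ a * zykov_base (Suc s) ^ m * zykov_base (Suc s) ^ r"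
    unfolding full eq1 eq2 ..
  finally show ?thesis using pos by simp
qed

text \<open>
  Let \<open>s > 0\<close>. Deleting a vertex \<open>v\<close> of degree at least \<open>s\<close> preserves the bound: \<open>V - {v}\<close> has one
  vertex less, while the independent sets through \<open>v\<close> live on at most \<open>m - 1 - s\<close> further vertices,
  with independence number smaller by one, and the two contributions add up to exactly
  the bound when the degree is \<open>s\<close>. If all degrees are below \<open>s\<close>, then the greedy bound gives
  \<open>m \<le> s a\<close>, and there the bound for \<open>s - 1\<close> is already at least as strong.
\<close>
lemma zykov_bound:
  assumes "finite V" "\<And>I. I \<in> indep_sets_of V E \<Longrightarrow> card I \<le> a"
  shows "real (num_indep_sets V E) \<le> zykov_coeff s ^ a * zykov_base s ^ card V"
  using assms
proof (induction s arbitrary: V a)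
  case 0
  have "num_indep_sets V E \<le> card (Pow V)"
    unfolding num_indep_sets_def using 0 by (intro card_mono) (auto simp: indep_sets_of_def)
  then have "num_indep_sets V E \<le> 2 ^ card V"
    using 0 by (simp add: card_Pow)
  then have "real (num_indep_sets V E) \<le> real (2 ^ card V)"
    by (rule of_nat_mono)
  then show ?case by (simp add: zykov_coeff_def zykov_base_def)
next
  case (Suc s)
  let ?A = "zykov_coeff (Suc s)" and ?B = "zykov_base (Suc s)"
  have A0: "?A > 0" and B1: "?B > 1"
    by (rule zykov_coeff_pos, rule zykov_base_gt_1)
  from Suc.prems show ?case
  proof (induction V arbitrary: a rule: finite_psubset_induct)
    case (psubset V)
    note fin = \<open>finite V\<close>
    show ?case
    proof (cases "\<exists>v\<in>V. card (nbrs V E v) \<ge> Suc s")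
      case False
      then have "\<exists>I\<in>indep_sets_of V E. card V \<le> Suc s * card I"
        using fin by (intro exists_large_indep_set) (auto simp: not_le)
      then have "card V \<le> Suc s * a"
        using psubset.prems by (meson le_trans mult_le_mono2)
      then show ?thesis
        using Suc.IH[OF fin psubset.prems] zykov_bound_mono by fastforce
    next
      case True
      then obtain v where v: "v \<in> V" and deg: "card (nbrs V E v) \<ge> Suc s" by blast
      let ?W = "V - insert v (nbrs V E v)"
      have "card {v} \<le> a"
        using v by (intro psubset.prems) (auto simp: indep_sets_of_def indep_def)
      then obtain b where b: "a = Suc b" by (cases a) auto
      have W: "card I \<le> b" if "I \<in> indep_sets_of ?W E" for I
      proof -
        have "v \<notin> I" "finite I"
          using that fin by (auto simp: indep_sets_of_def intro: finite_subset)
        then show ?thesis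
          using psubset.prems[OF insert_in_indep_sets_of[OF v that]] b by simp
      qed
      have "real (num_indep_sets (V - {v}) E) \<le> ?A ^ a * ?B ^ card (V - {v})"
        using v psubset.prems indep_sets_of_mono[of "V - {v}" V]
        by (intro psubset.IH) auto
      moreover have "real (num_indep_sets ?W E) \<le> ?A ^ b * ?B ^ card ?W"
        using v W by (intro psubset.IH) auto
      ultimately have "real (num_indep_sets V E)
          \<le> ?A ^ a * ?B ^ card (V - {v}) + ?A ^ b * ?B ^ card ?W"
        using num_indep_sets_split[OF fin v] by simp
      also have "\<dots> \<le> ?A ^ a * ?B ^ card V"
      proof -
        define m where "m = card ?W"
        have sub: "insert v (nbrs V E v) \<subseteq> V" using v by (auto simp: nbrs_def)
        have "v \<notin> nbrs V E v" by (simp add: nbrs_def)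
        then have "card (insert v (nbrs V E v)) \<ge> Suc (Suc s)"
          using deg fin by simp
        moreover have "card ?W + card (insert v (nbrs V E v)) = card V"
          using sub fin by (metis card_Diff_subset card_mono finite_subset le_add_diff_inverse2)
        ultimately have le: "m + Suc s \<le> card (V - {v})"
          using v fin by (simp add: m_def)
        define l where "l = card (V - {v})"
        have cV: "card V = Suc l"
          using card_Suc_Diff1[OF fin v] by (simp add: l_def)
        have key: "?A * ?B ^ Suc s = 2 + real s"
          using B1 by (simp add: zykov_coeff_def)
        \<comment> \<open>The second contribution is at most the fraction \<open>?B - 1 = 1 / (2 + s)\<close> of the first.\<close>
        have "(2 + real s) * ?B ^ m = ?A * ?B ^ (m + Suc s)"
          unfolding power_add using key by (metis mult.assoc mult.commute)
        also have "\<dots> \<le> ?A * ?B ^ l"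
          using A0 B1 le unfolding l_def by (intro mult_left_mono power_increasing) auto
        finally have "?B ^ m \<le> ?A * ?B ^ l / (2 + real s)"
          by (simp add: field_simps)
        moreover have "?A * ?B ^ l + ?A * ?B ^ l / (2 + real s) = ?A * ?B ^ Suc l"
        proof -
          have "x + x / (2 + real s) = x * ?B" for x :: real
            by (simp add: zykov_base_def field_simps)
          then show ?thesis by simp
        qed
        ultimately have "?A * ?B ^ l + ?B ^ m \<le> ?A * ?B ^ Suc l" by linarith
        then have "?A ^ b * (?A * ?B ^ l + ?B ^ m) \<le> ?A ^ b * (?A * ?B ^ Suc l)"
          using A0 by (intro mult_left_mono) auto
        then show ?thesis
          unfolding cV b m_def[symmetric] l_def[symmetric] by (simp add: algebra_simps)
      qed
      finally show ?thesis .
    qed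
  qed
qed

section \<open>Fingerprints and containers in regular graphs\<close>

definition nbhd :: "'a set \<Rightarrow> 'a set set \<Rightarrow> 'a set \<Rightarrow> 'a set" where
  "nbhd V E T = (\<Union>t\<in>T. nbrs V E t)"

text \<open>
  The set \<open>T\<close> is meant to be part of an independent set \<open>I\<close>. Then \<open>I\<close> avoids the neighbours of
  \<open>T\<close>, and if \<open>T\<close> is suitably saturated, every vertex of \<open>I\<close> has fewer than \<open>\<phi>\<close>
  neighbours that are not neighbours of \<open>T\<close>. The container consists of all vertices that
  satisfy these two constraints.
\<close>
definition container :: "'a set \<Rightarrow> 'a set set \<Rightarrow> real \<Rightarrow> 'a set \<Rightarrow> 'a set" where
  "container V E \<phi> T = {v \<in> V - nbhd V E T. real (card (nbrs V E v - nbhd V E T)) < \<phi>}"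

lemma nbhd_subset: "nbhd V E T \<subseteq> V"
  by (auto simp: nbhd_def nbrs_def)

text \<open>
  Sapozhenko's argument: add vertices of \<open>I\<close> to \<open>T\<close> as long as each contributes at least \<open>\<phi>\<close> new
  neighbours. Since there are only \<open>card V\<close> possible neighbours, this stops with
  \<open>\<phi> * card T \<le> card V\<close>, and no vertex of \<open>I\<close> can then contribute \<open>\<phi>\<close> new neighbours.
\<close>
lemma exists_fingerprint:
  assumes "finite V" "I \<in> indep_sets_of V E" "\<phi> > 0"
  shows "\<exists>T\<subseteq>V. \<phi> * real (card T) \<le> real (card V) \<and> I \<in> indep_sets_of (container V E \<phi> T) E"
proof -
  have IV: "I \<subseteq> V" and ind: "indep I E" and "finite I"
    using assms by (auto simp: indep_sets_of_def intro: finite_subset)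
  \<comment> \<open>A set of maximal size with this property replaces the final state of the greedy process.\<close>
  let ?P = "\<lambda>T. T \<subseteq> I \<and> \<phi> * real (card T) \<le> real (card (nbhd V E T))"
  have "?P {}" by (simp add: nbhd_def)
  moreover have "\<forall>T. ?P T \<longrightarrow> card T < Suc (card I)"
    using \<open>finite I\<close> by (auto simp: less_Suc_eq_le intro: card_mono)
  ultimately have "\<exists>T. ?P T \<and> (\<forall>T'. ?P T' \<longrightarrow> card T' \<le> card T)"
    by (rule Lattices_Big.ex_has_greatest_nat)
  then obtain T where T: "?P T" and max: "\<And>T'. ?P T' \<Longrightarrow> card T' \<le> card T"
    by (elim exE conjE) (rule that, auto)
  have fT: "finite T" using T \<open>finite I\<close> by (auto intro: finite_subset)
  have fN: "finite (nbhd V E S)" for S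
    using nbhd_subset assms(1) by (rule finite_subset)
  have few: "real (card (nbrs V E u - nbhd V E T)) < \<phi>" if u: "u \<in> I" for u
  proof (rule ccontr)
    assume "\<not> ?thesis"
    then have ge: "real (card (nbrs V E u - nbhd V E T)) \<ge> \<phi>" by simp
    have "u \<notin> T"
    proof
      assume "u \<in> T"
      then have "nbrs V E u - nbhd V E T = {}" by (auto simp: nbhd_def)
      with ge assms(3) show False by simp
    qed
    have "nbhd V E (insert u T) = nbhd V E T \<union> (nbrs V E u - nbhd V E T)"
      by (auto simp: nbhd_def)
    then have "card (nbhd V E (insert u T)) = card (nbhd V E T) + card (nbrs V E u - nbhd V E T)"
      using card_Un_disjoint[of "nbhd V E T" "nbrs V E u - nbhd V E T"] fN assms(1) by auto
    then have "?P (insert u T)"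
      using T ge u fT \<open>u \<notin> T\<close> by (simp add: algebra_simps)
    from max[OF this] show False using fT \<open>u \<notin> T\<close> by simp
  qed
  have "I \<inter> nbhd V E T = {}"
    using ind T by (fastforce simp: nbhd_def nbrs_def indep_def)
  then have "I \<subseteq> container V E \<phi> T"
    using few IV by (auto simp: container_def)
  moreover have "\<phi> * real (card T) \<le> real (card V)"
    using T card_mono[OF assms(1) nbhd_subset[of V E T]] by linarith
  ultimately show ?thesis
    using T IV ind by (intro exI[of _ T]) (auto simp: indep_sets_of_def)
qed

text \<open>
  Count the edges between the container \<open>D\<close> and the neighbourhood \<open>M\<close> of \<open>T\<close>, which are disjoint.
  Every vertex of \<open>D\<close> sends at least \<open>d - \<phi>\<close> edges to \<open>M\<close>, and every vertex of \<open>M\<close> receives at most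
  \<open>d\<close>.
\<close>
lemma card_container_le:
  assumes "finite V" "\<And>v. v \<in> V \<Longrightarrow> card (nbrs V E v) = d"
  shows "real (card (container V E \<phi> T)) * (2 * real d - \<phi>) \<le> real (card V) * real d"
proof -
  define M where "M = nbhd V E T"
  define D where "D = container V E \<phi> T"
  have MV: "M \<subseteq> V" and DV: "D \<subseteq> V" and disj: "D \<inter> M = {}"
    using nbhd_subset[of V E T] by (auto simp: M_def D_def container_def)
  have fin: "finite M" "finite D" using MV DV assms(1) by (auto intro: finite_subset)
  have "real (card D) * (real d - \<phi>) = (\<Sum>v\<in>D. real d - \<phi>)" by simp
  also have "\<dots> \<le> (\<Sum>v\<in>D. real (card {w \<in> M. w \<in> nbrs V E v}))"
  proof (rule sum_mono)
    fix v assume v: "v \<in> D"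
    have "nbrs V E v = {w \<in> M. w \<in> nbrs V E v} \<union> (nbrs V E v - M)" by auto
    then have "card (nbrs V E v) \<le> card {w \<in> M. w \<in> nbrs V E v} + card (nbrs V E v - M)"
      by (metis card_Un_le)
    moreover have "card (nbrs V E v) = d" "real (card (nbrs V E v - M)) < \<phi>"
      using v DV assms(2) by (auto simp: D_def M_def container_def)
    ultimately show "real d - \<phi> \<le> real (card {w \<in> M. w \<in> nbrs V E v})" by linarith
  qed
  also have "\<dots> = real (\<Sum>v\<in>D. card {w \<in> M. w \<in> nbrs V E v})" by simp
  also have "(\<Sum>v\<in>D. card {w \<in> M. w \<in> nbrs V E v}) = (\<Sum>w\<in>M. card {v \<in> D. w \<in> nbrs V E v})"
    using fin by (intro sum_multicount_gen) auto
  also have "real \<dots> \<le> real (\<Sum>w\<in>M. d)"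
  proof (intro of_nat_mono sum_mono)
    fix w assume w: "w \<in> M"
    have "{v \<in> D. w \<in> nbrs V E v} \<subseteq> nbrs V E w"
      using w DV MV nbrs_sym[of w V _ E] by blast
    then have "card {v \<in> D. w \<in> nbrs V E v} \<le> card (nbrs V E w)"
      using assms(1) by (intro card_mono) auto
    also have "\<dots> = d" using w MV assms(2) by auto
    finally show "card {v \<in> D. w \<in> nbrs V E v} \<le> d" .
  qed
  also have "\<dots> = real (card M) * real d" by simp
  finally have 1: "real (card D) * (real d - \<phi>) \<le> real (card M) * real d" .
  have "card D + card M \<le> card V"
    using card_mono[of V "D \<union> M"] card_Un_disjoint[OF fin(2,1) disj] MV DV assms(1) by simp
  then have "(real (card D) + real (card M)) * real d \<le> real (card V) * real d"
    by (intro mult_right_mono) (auto simp flip: of_nat_add)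
  with 1 show ?thesis unfolding D_def[symmetric] by (simp add: algebra_simps)
qed

text \<open>
  Give each \<open>T\<close> the weight \<open>(1 / \<phi>) ^ card T\<close>. By the binomial theorem the total weight of all
  subsets of \<open>V\<close> is \<open>(1 + 1 / \<phi>) ^ card V\<close>, and each of the small subsets weighs at least
  \<open>\<phi> powr (- card V / \<phi>)\<close>.
\<close>
lemma card_small_subsets_le:
  assumes "finite V" "\<phi> \<ge> 1"
  shows "real (card {T. T \<subseteq> V \<and> \<phi> * real (card T) \<le> real (card V)})
       \<le> (1 + 1 / \<phi>) ^ card V * \<phi> powr (real (card V) / \<phi>)"
proof -
  let ?S = "{T. T \<subseteq> V \<and> \<phi> * real (card T) \<le> real (card V)}"
  have "real (card ?S) = (\<Sum>T\<in>?S. 1)" by simp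
  also have "\<dots> \<le> (\<Sum>T\<in>?S. (1 / \<phi>) ^ card T * \<phi> powr (real (card V) / \<phi>))"
  proof (rule sum_mono)
    fix T assume T: "T \<in> ?S"
    then have "real (card T) \<le> real (card V) / \<phi>"
      using assms(2) by (simp add: field_simps)
    then have "\<phi> ^ card T \<le> \<phi> powr (real (card V) / \<phi>)"
      using assms(2) by (subst powr_realpow[symmetric]) (auto intro: powr_mono)
    then show "1 \<le> (1 / \<phi>) ^ card T * \<phi> powr (real (card V) / \<phi>)"
      using assms(2) by (simp add: field_simps)
  qed
  also have "\<dots> \<le> (\<Sum>T\<in>Pow V. (1 / \<phi>) ^ card T * \<phi> powr (real (card V) / \<phi>))"
    using assms by (intro sum_mono2) auto
  also have "\<dots> = (\<Sum>T\<in>Pow V. (1 / \<phi>) ^ card T) * \<phi> powr (real (card V) / \<phi>)"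
    by (simp add: sum_distrib_right)
  also have "(\<Sum>T\<in>Pow V. (1 / \<phi>) ^ card T) = (1 + 1 / \<phi>) ^ card V"
    using prod_add[OF assms(1), of "\<lambda>_. 1 / \<phi>" "\<lambda>_. 1"] by (simp add: add.commute)
  finally show ?thesis .
qed

text \<open>
  Every independent set is recorded by its fingerprint and a set inside the container of that
  fingerprint: the first two factors bound the number of fingerprints, the others come from
  Zykov's bound for one container.
\<close>
lemma num_indep_sets_regular_le:
  fixes \<phi> :: real
  assumes fin: "finite V" and reg: "\<And>v. v \<in> V \<Longrightarrow> card (nbrs V E v) = d"
    and indep: "\<And>I. I \<in> indep_sets_of V E \<Longrightarrow> card I \<le> a"
    and \<phi>: "1 \<le> \<phi>" "\<phi> \<le> real d"
  defines "n \<equiv> card V"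
  shows "real (num_indep_sets V E)
       \<le> (1 + 1 / \<phi>) ^ n * \<phi> powr (real n / \<phi>) *
         (zykov_coeff s ^ a * zykov_base s powr (real n * real d / (2 * real d - \<phi>)))"
proof -
  let ?S = "{T. T \<subseteq> V \<and> \<phi> * real (card T) \<le> real (card V)}"
  let ?bound = "zykov_coeff s ^ a * zykov_base s powr (real n * real d / (2 * real d - \<phi>))"
  have finS: "finite ?S" using fin by simp
  have cV: "container V E \<phi> T \<subseteq> V" for T by (auto simp: container_def)
  have fc: "finite (container V E \<phi> T)" for T using cV fin by (rule finite_subset)
  have "indep_sets_of V E \<subseteq> (\<Union>T\<in>?S. indep_sets_of (container V E \<phi> T) E)"
  proof
    fix I assume "I \<in> indep_sets_of V E"
    from exists_fingerprint[OF fin this, of \<phi>] \<phi>(1)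
    obtain T where "T \<in> ?S" "I \<in> indep_sets_of (container V E \<phi> T) E" by auto
    then show "I \<in> (\<Union>T\<in>?S. indep_sets_of (container V E \<phi> T) E)" by blast
  qed
  then have "num_indep_sets V E \<le> card (\<Union>T\<in>?S. indep_sets_of (container V E \<phi> T) E)"
    unfolding num_indep_sets_def using finS fc by (intro card_mono) auto
  also have "\<dots> \<le> (\<Sum>T\<in>?S. num_indep_sets (container V E \<phi> T) E)"
    unfolding num_indep_sets_def by (rule card_UN_le[OF finS])
  finally have "real (num_indep_sets V E) \<le> (\<Sum>T\<in>?S. real (num_indep_sets (container V E \<phi> T) E))"
    unfolding of_nat_sum[symmetric] by (rule of_nat_mono)
  also have "\<dots> \<le> (\<Sum>T\<in>?S. ?bound)"
  proof (rule sum_mono)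
    fix T
    let ?C = "container V E \<phi> T"
    have "real (num_indep_sets ?C E) \<le> zykov_coeff s ^ a * zykov_base s ^ card ?C"
      using indep indep_sets_of_mono[OF cV] fc by (intro zykov_bound) auto
    also have "real (card ?C) \<le> real n * real d / (2 * real d - \<phi>)"
      using card_container_le[OF fin reg, where T = T and \<phi> = \<phi>] \<phi>
    by (simp add: n_def pos_le_divide_eq)
    then have "zykov_base s ^ card ?C \<le> zykov_base s powr (real n * real d / (2 * real d - \<phi>))"
      using zykov_base_gt_1[of s] by (subst powr_realpow[symmetric]) (auto intro: powr_mono)
    then have "zykov_coeff s ^ a * zykov_base s ^ card ?C \<le> ?bound"
      using zykov_coeff_pos[of s] by (intro mult_left_mono) auto
    finally show "real (num_indep_sets ?C E) \<le> ?bound" .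
  qed
  also have "\<dots> = real (card ?S) * ?bound" by simp
  also have "\<dots> \<le> (1 + 1 / \<phi>) ^ n * \<phi> powr (real n / \<phi>) * ?bound"
    using card_small_subsets_le[OF fin \<phi>(1)] zykov_coeff_pos[of s] unfolding n_def
    by (intro mult_right_mono) auto
  finally show ?thesis .
qed

section \<open>Two joined copies of a union of cliques\<close>

text \<open>
  The vertex \<open>2 * p + b\<close> with \<open>b < 2\<close> is the vertex at position \<open>p\<close> of side \<open>b\<close>. On each side the
  positions that agree modulo \<open>q\<close> form a clique. Vertices of opposite sides are adjacent unless
  they have the same position and their residue is below \<open>y\<close>; for \<open>h = s * q + y\<close> positions these
  are the residues whose classes have \<open>s + 1\<close> elements. The exceptions are the deleted perfect matching
  between the large cliques.
\<close>
definition two_sided_adj :: "nat \<Rightarrow> nat \<Rightarrow> nat \<Rightarrow> nat \<Rightarrow> bool" where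
  "two_sided_adj q y u v \<longleftrightarrow>
     (if even u = even v then u \<noteq> v \<and> u div 2 mod q = v div 2 mod q
      else u div 2 \<noteq> v div 2 \<or> u div 2 mod q \<ge> y)"

definition two_sided_edges :: "nat \<Rightarrow> nat \<Rightarrow> nat \<Rightarrow> nat set set" where
  "two_sided_edges h q y = {{u, v} | u v. u < 2 * h \<and> v < 2 * h \<and> two_sided_adj q y u v}"

lemma two_sided_adj_sym: "two_sided_adj q y u v = two_sided_adj q y v u"
  by (auto simp: two_sided_adj_def)

lemma two_sided_adj_irrefl: "\<not> two_sided_adj q y u u"
  by (simp add: two_sided_adj_def)

lemma in_two_sided_edges_iff:
  "{u, v} \<in> two_sided_edges h q y \<longleftrightarrow> u < 2 * h \<and> v < 2 * h \<and> two_sided_adj q y u v"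
  unfolding two_sided_edges_def using two_sided_adj_sym by (auto simp: doubleton_eq_iff)

lemma simple_graph_two_sided: "simple_graph {..<2 * h} (two_sided_edges h q y)"
  unfolding simple_graph_def two_sided_edges_def nsets_def
  using two_sided_adj_irrefl by (auto simp: card_insert_if)

lemma residue_class_index_iff:
  fixes h q s y r :: nat
  assumes "h = s * q + y" "y \<le> q" "r < q"
  shows "r + q * j < h \<longleftrightarrow> j < (if r < y then Suc s else s)"
proof (cases j s rule: linorder_cases)
  case less
  then have "q * Suc j \<le> q * s" by (intro mult_le_mono2) simp
  then show ?thesis using less assms by (simp add: algebra_simps)
next
  case equal
  then show ?thesis using assms by (simp add: algebra_simps)
next
  case greater
  then have "q * Suc s \<le> q * j" by (intro mult_le_mono2) simp
  then show ?thesis using greater assms by (simp add: algebra_simps)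
qed

lemma card_residue_class:
  fixes h q s y r :: nat
  assumes "h = s * q + y" "y \<le> q" "r < q"
  shows "card {p. p < h \<and> p mod q = r} = (if r < y then Suc s else s)"
proof -
  let ?t = "if r < y then Suc s else s"
  have "{p. p < h \<and> p mod q = r} = (\<lambda>j. r + q * j) ` {..<?t}"
  proof (intro equalityI subsetI)
    fix p assume p: "p \<in> {p. p < h \<and> p mod q = r}"
    then have "p = r + q * (p div q)" by (auto simp: mod_mult_div_eq)
    with p residue_class_index_iff[OF assms, of "p div q"]
    show "p \<in> (\<lambda>j. r + q * j) ` {..<?t}" by auto
  next
    fix p assume "p \<in> (\<lambda>j. r + q * j) ` {..<?t}"
    then obtain j where j: "p = r + q * j" "j < ?t" by blast
    then show "p \<in> {p. p < h \<and> p mod q = r}"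
      using residue_class_index_iff[OF assms, of j] assms(3) by simp
  qed
  moreover have "inj_on (\<lambda>j. r + q * j) {..<?t}"
    using assms by (auto intro!: inj_onI)
  ultimately show ?thesis by (simp add: card_image)
qed

text \<open>
  A vertex in a clique of order \<open>s\<close> has \<open>s - 1\<close> neighbours on its side and \<open>h\<close> on the other; a
  vertex in a clique of order \<open>s + 1\<close> has \<open>s\<close> and \<open>h - 1\<close>.
\<close>
lemma regular_two_sided:
  assumes h: "h = s * q + y" "y \<le> q" and q: "0 < q"
  shows "regular_graph (h + s - 1) {..<2 * h} (two_sided_edges h q y)"
  unfolding regular_graph_def
proof
  fix v assume v: "v \<in> {..<2 * h}"
  define p where "p = v div 2"
  define b where "b = v mod 2"
  have b: "b < 2" and vp: "v = 2 * p + b" by (simp_all add: p_def b_def)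
  have ph: "p < h" using v b vp by simp
  define C where "C = {p'. p' < h \<and> p' mod q = p mod q}"
  \<comment> \<open>The positions on the opposite side to which \<open>v\<close> is not adjacent.\<close>
  define F where "F = (if p mod q < y then {p} else {})"
  define same where "same = (\<lambda>p'. 2 * p' + b) ` (C - {p})"
  define opp where "opp = (\<lambda>p'. 2 * p' + (1 - b)) ` ({..<h} - F)"
  have cC: "card C = (if p mod q < y then Suc s else s)" "finite C"
    unfolding C_def using card_residue_class[OF h, of "p mod q"] q by auto
  have "{w \<in> {..<2 * h}. {v, w} \<in> two_sided_edges h q y} = same \<union> opp"
  proof (intro equalityI subsetI)
    fix w assume "w \<in> {w \<in> {..<2 * h}. {v, w} \<in> two_sided_edges h q y}"
    then have w: "w < 2 * h" "two_sided_adj q y v w" by (auto simp: in_two_sided_edges_iff)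
    have wh: "w div 2 < h" using w by simp
    show "w \<in> same \<union> opp"
    proof (cases "even v = even w")
      case True
      then have "w = 2 * (w div 2) + b" unfolding b_def by (metis mod2_eq_if mult_div_mod_eq)
      moreover have "w div 2 \<in> C - {p}"
      proof -
        have "w div 2 \<noteq> p"
          using calculation vp w two_sided_adj_irrefl by metis
        then show ?thesis
          using w True wh by (auto simp: two_sided_adj_def C_def p_def)
      qed
      ultimately show ?thesis unfolding same_def by blast
    next
      case False
      then have "w = 2 * (w div 2) + (1 - b)" unfolding b_def by (auto simp: mod2_eq_if)
      moreover have "w div 2 \<in> {..<h} - F"
        using w False wh unfolding two_sided_adj_def F_def p_def by auto
      ultimately show ?thesis unfolding opp_def by blast
    qed
  next
    fix w assume "w \<in> same \<union> opp"
    then show "w \<in> {w \<in> {..<2 * h}. {v, w} \<in> two_sided_edges h q y}"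
    proof
      assume "w \<in> same"
      then obtain p' where p': "p' \<in> C" "p' \<noteq> p" "w = 2 * p' + b" by (auto simp: same_def)
      then have "w < 2 * h" "w div 2 = p'" "even v = even w" "w \<noteq> v"
        using b vp by (auto simp: C_def)
      then show ?thesis
        using v p' by (auto simp: in_two_sided_edges_iff two_sided_adj_def C_def p_def)
    next
      assume "w \<in> opp"
      then obtain p' where p': "p' < h" "p' \<notin> F" "w = 2 * p' + (1 - b)" by (auto simp: opp_def)
      have "w < 2 * h" "w div 2 = p'" "even v \<noteq> even w"
        using b vp p' by (auto simp: less_2_cases_iff)
      then show ?thesis
        using v p' by (auto simp: in_two_sided_edges_iff two_sided_adj_def F_def p_def split: if_splits)
    qed
  qed
  moreover have "same \<inter> opp = {}"
    using b by (auto simp: same_def opp_def less_2_cases_iff) presburger+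
  moreover have "card same = card C - 1"
    unfolding same_def using ph cC by (subst card_image) (auto simp: inj_on_def C_def)
  moreover have "card opp = h - card F"
  proof -
    have "card opp = card ({..<h} - F)"
      unfolding opp_def by (rule card_image) (auto simp: inj_on_def)
    then show ?thesis using ph by (auto simp: F_def)
  qed
  moreover have "finite same" "finite opp" using cC(2) by (auto simp: same_def opp_def)
  moreover have "p \<in> C" using ph by (simp add: C_def)
  then have "card C > 0" using cC(2) card_gt_0_iff by blast
  ultimately show "card {w \<in> {..<2 * h}. {v, w} \<in> two_sided_edges h q y} = h + s - 1"
    using cC(1) ph by (auto simp: card_Un_disjoint F_def)
qed

text \<open>
  An independent set on one side meets each of the \<open>q\<close> cliques at most once. If it meets both sides,
  then any two of its vertices on opposite sides are partners in the deleted matching, so it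
  consists of one such pair.
\<close>
lemma card_indep_two_sided_le:
  assumes q: "0 < q" and I: "I \<in> indep_sets_of {..<2 * h} (two_sided_edges h q y)"
  shows "card I \<le> max 2 q"
proof (cases "\<exists>u\<in>I. \<exists>v\<in>I. even u \<and> odd v")
  case False
  have na: "\<not> two_sided_adj q y u v" if "u \<in> I" "v \<in> I" "u \<noteq> v" for u v
    using I that by (force simp: indep_sets_of_def indep_def in_two_sided_edges_iff)
  have "inj_on (\<lambda>v. v div 2 mod q) I"
  proof (rule inj_onI, rule ccontr)
    fix u v assume "u \<in> I" "v \<in> I" "u div 2 mod q = v div 2 mod q" "u \<noteq> v"
    with na[of u v] False show False unfolding two_sided_adj_def by metis
  qed
  then have "card I = card ((\<lambda>v. v div 2 mod q) ` I)" by (rule card_image[symmetric])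
  also have "\<dots> \<le> card {..<q}" using q by (intro card_mono) auto
  finally show ?thesis by simp
next
  case True
  then obtain u v where uv: "u \<in> I" "v \<in> I" "even u" "odd v" by blast
  have na: "\<not> two_sided_adj q y u v" if "u \<in> I" "v \<in> I" "u \<noteq> v" for u v
    using I that by (force simp: indep_sets_of_def indep_def in_two_sided_edges_iff)
  have eq: "w div 2 = w' div 2" if "w \<in> I" "w' \<in> I" "even w" "odd w'" for w w'
    using na[OF that(1,2)] that(3,4) by (auto simp: two_sided_adj_def)
  have "I \<subseteq> {u, v}"
  proof
    fix w assume w: "w \<in> I"
    show "w \<in> {u, v}"
    proof (cases "even w")
      case True
      then have "w div 2 = u div 2" using eq[OF w uv(2) True uv(4)] eq[OF uv] by simp
      then show ?thesis using True uv by (metis dvd_div_mult_self insertI1)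
    next
      case False
      then have "w div 2 = v div 2" using eq[OF uv(1) w uv(3) False] eq[OF uv] by simp
      then show ?thesis using False uv by (metis insert_iff odd_two_times_div_two_succ)
    qed
  qed
  then have "card I \<le> card {u, v}" by (intro card_mono) auto
  also have "\<dots> \<le> 2" by (simp add: card_insert_if)
  finally show ?thesis by simp
qed

text \<open>
  The independent sets inside the even side already suffice. Each is a choice, for every clique, of
  no vertex or one vertex.
\<close>
lemma num_indep_sets_two_sided_ge:
  assumes h: "h = s * q + y" "y \<le> q" and q: "0 < q"
  shows "(Suc s) ^ (q - y) * (Suc (Suc s)) ^ y
         \<le> num_indep_sets {..<2 * h} (two_sided_edges h q y)"
proof -
  let ?t = "\<lambda>r. if r < y then Suc s else s"
  let ?X = "PiE {..<q} (\<lambda>r. {..?t r})"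
  \<comment> \<open>The value \<open>f r = 0\<close> stands for choosing no vertex of clique \<open>r\<close>, the value \<open>Suc j\<close> for position \<open>r + q * j\<close>.\<close>
  define g where "g f = (\<lambda>p. 2 * p) ` {p. p < h \<and> f (p mod q) = Suc (p div q)}" for f :: "nat \<Rightarrow> nat"
  have inj: "inj_on g ?X"
  proof (rule inj_onI)
    fix f f' assume f: "f \<in> ?X" and f': "f' \<in> ?X" and eq: "g f = g f'"
    have half: "f r = Suc j \<Longrightarrow> f' r = Suc j"
      if "f \<in> ?X" "g f = g f'" "r < q" for f f' r j
    proof -
      assume fr: "f r = Suc j"
      have "f r \<le> ?t r" using that by (auto simp: PiE_iff)
      then have j: "j < ?t r" using fr by simp
      let ?p = "r + q * j"
      have "?p < h" using residue_class_index_iff[OF h that(3)] j by simp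
      then have "2 * ?p \<in> g f" unfolding g_def using fr that(3) by (intro imageI) simp
      then have "2 * ?p \<in> g f'" using that(2) by simp
      then obtain p where "2 * ?p = 2 * p" "f' (p mod q) = Suc (p div q)"
        unfolding g_def by blast
      moreover from this have "p = ?p" by simp
      ultimately have "f' (?p mod q) = Suc (?p div q)" by simp
      then show "f' r = Suc j" using that(3) by simp
    qed
    show "f = f'"
    proof (rule PiE_ext[OF f f'])
      fix r assume "r \<in> {..<q}"
      then have r: "r < q" by simp
      show "f r = f' r"
        using half[OF f eq r] half[OF f' eq[symmetric] r] by (metis not0_implies_Suc)
    qed
  qed
  have sub: "g ` ?X \<subseteq> indep_sets_of {..<2 * h} (two_sided_edges h q y)"
  proof (rule image_subsetI)
    fix f assume "f \<in> ?X"
    have "\<not> two_sided_adj q y u v" if u: "u \<in> g f" and v: "v \<in> g f" for u v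
    proof
      assume adj: "two_sided_adj q y u v"
      obtain p where p: "u = 2 * p" "f (p mod q) = Suc (p div q)"
        using u unfolding g_def by blast
      obtain p' where p': "v = 2 * p'" "f (p' mod q) = Suc (p' div q)"
        using v unfolding g_def by blast
      have "p \<noteq> p'" and mod: "p mod q = p' mod q"
        using adj p(1) p'(1) by (simp_all add: two_sided_adj_def)
      moreover have "p div q = p' div q" using p(2) p'(2) mod by simp
      ultimately show False by (metis mult_div_mod_eq)
    qed
    moreover have "g f \<subseteq> {..<2 * h}" by (auto simp: g_def)
    ultimately show "g f \<in> indep_sets_of {..<2 * h} (two_sided_edges h q y)"
      by (simp add: indep_sets_of_def indep_def in_two_sided_edges_iff)
  qed
  have "(Suc s) ^ (q - y) * (Suc (Suc s)) ^ y = (\<Prod>r<q. Suc (?t r))"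
  proof -
    have split: "{..<q} \<inter> {r. r < y} = {..<y}" "{..<q} \<inter> - {r. r < y} = {y..<q}"
      using h(2) by auto
    have "(\<Prod>r<q. if r < y then Suc (Suc s) else Suc s) = Suc (Suc s) ^ y * Suc s ^ (q - y)"
      by (simp only: prod.If_cases[OF finite_lessThan] split) simp
    moreover have "(\<Prod>r<q. Suc (?t r)) = (\<Prod>r<q. if r < y then Suc (Suc s) else Suc s)"
      by (rule prod.cong) auto
    ultimately show ?thesis by simp
  qed
  also have "\<dots> = card ?X" by (subst card_PiE) auto
  also have "\<dots> = card (g ` ?X)" using inj by (simp add: card_image)
  also have "\<dots> \<le> num_indep_sets {..<2 * h} (two_sided_edges h q y)"
    unfolding num_indep_sets_def using sub by (intro card_mono) auto
  finally show ?thesis .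
qed

lemma nda_graph_two_sided:
  assumes h: "h = s * q + y" "y \<le> q" and q: "2 \<le> q"
  shows "nda_graph (2 * h) (h + s - 1) q {..<2 * h} (two_sided_edges h q y)"
proof -
  have "independence_number {..<2 * h} (two_sided_edges h q y) \<le> q"
    unfolding independence_number_def
    using card_indep_two_sided_le[of q _ h y] q
    by (subst Max_le_iff) (auto simp: max_def split: if_splits)
  then show ?thesis
    using simple_graph_two_sided regular_two_sided[OF h] q by (auto simp: nda_graph_def)
qed

section \<open>Asymptotics\<close>

lemma floor_half_inverse:
  fixes c :: real
  assumes "0 < c" "c \<le> 1 / 2"
  defines "s \<equiv> nat \<lfloor>1 / (2 * c)\<rfloor>"
  shows "1 \<le> s" "c * real s \<le> 1 / 2" "1 / 2 < c * (real s + 1)"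
proof -
  have "1 / (2 * c) \<ge> 1" using assms by (simp add: field_simps)
  then have ge: "\<lfloor>1 / (2 * c)\<rfloor> \<ge> 1" by (simp only: one_le_floor)
  then show "1 \<le> s" unfolding s_def by linarith
  have s: "real s = of_int \<lfloor>1 / (2 * c)\<rfloor>"
    unfolding s_def by (rule of_nat_nat) (use ge in linarith)
  have "real s \<le> 1 / (2 * c)" "1 / (2 * c) < real s + 1"
    unfolding s by (rule of_int_floor_le) (rule real_of_int_floor_add_one_gt)
  then show "c * real s \<le> 1 / 2" "1 / 2 < c * (real s + 1)"
    using assms(1) by (auto simp: field_simps)
qed

text \<open>
  When \<open>1 / (2 * c)\<close> is an integer, \<open>c * s = 1 / 2\<close>, so the second exponent vanishes and the first one
  becomes \<open>c\<close>; this is why one formula covers both cases. That \<open>k_ind c > 1\<close> is needed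
  to absorb errors into the exponent.
\<close>
lemma ln_k_ind:
  fixes c :: real
  assumes c: "0 < c" "c \<le> 1 / 2"
  defines "s \<equiv> nat \<lfloor>1 / (2 * c)\<rfloor>"
  shows "ln (k_ind c) = (c * (real s + 1) - 1 / 2) * ln (1 + real s) + (1 / 2 - c * real s) * ln (2 + real s)"
    and "k_ind c > 1"
proof -
  note s = floor_half_inverse[OF c, folded s_def]
  have fl: "of_int \<lfloor>1 / (2 * c)\<rfloor> = real s" using s(1) by (simp add: s_def)
  have k: "k_ind c = (1 + real s) powr (c * (real s + 1) - 1 / 2) * (2 + real s) powr (1 / 2 - c * real s)"
  proof (cases "1 / (2 * c) \<in> \<int>")
    case True
    then obtain z where "1 / (2 * c) = of_int z" by (rule Ints_cases)
    with fl have eq: "1 / (2 * c) = real s" by (metis floor_of_int)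
    then have "c * real s = 1 / 2" using c by (simp add: field_simps)
    then have exps: "c * (real s + 1) - 1 / 2 = c" "1 / 2 - c * real s = 0"
      by (simp_all add: algebra_simps)
    have "k_ind c = (1 + real s) powr c" unfolding k_ind_def eq by simp
    then show ?thesis unfolding exps by simp
  next
    case False
    then have "\<lceil>1 / (2 * c)\<rceil> = \<lfloor>1 / (2 * c)\<rfloor> + 1" by (simp add: ceiling_altdef) (metis Ints_of_int)
    then have "of_int \<lceil>1 / (2 * c)\<rceil> = real s + 1" using fl by simp
    then show ?thesis using False fl unfolding k_ind_def by (simp add: add_ac)
  qed
  show ln: "ln (k_ind c) = (c * (real s + 1) - 1 / 2) * ln (1 + real s) + (1 / 2 - c * real s) * ln (2 + real s)"
    unfolding k by (simp add: ln_mult)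
  have "(c * (real s + 1) - 1 / 2) * ln (1 + real s) > 0" "(1 / 2 - c * real s) * ln (2 + real s) \<ge> 0"
    using s by auto
  then have "ln (k_ind c) > 0" unfolding ln by linarith
  moreover have "k_ind c > 0" unfolding k by simp
  ultimately show "k_ind c > 1" by simp
qed

lemma along_le: "along N \<le> sequentially"
  by simp

lemma eventually_in_along: "(\<And>n. n \<in> N \<Longrightarrow> P n) \<Longrightarrow> eventually P (along N)"
  by (simp add: eventually_inf_principal)

lemma along_neq_bot: "infinite N \<Longrightarrow> along N \<noteq> bot"
  by (auto simp: trivial_limit_def eventually_inf_principal eventually_sequentially
        infinite_nat_iff_unbounded_le)

text \<open>
  Turns a bound of the form \<open>exp (n * u n)\<close> with \<open>u n \<longrightarrow> ln k\<close> into one of the form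
  \<open>k powr (n * (1 + \<epsilon> n))\<close> with \<open>\<epsilon> n = u n / ln k - 1 \<longrightarrow> 0\<close>.
\<close>
lemma powr_eq_exp_scaled:
  fixes k :: real
  assumes "k > 1"
  shows "k powr (x * (1 + (u / ln k - 1))) = exp (x * u)"
  using assms by (simp add: powr_def)

text \<open>
  The bound of \<open>num_indep_sets_regular_le\<close> with \<open>\<phi> = sqrt d\<close>: this choice makes both \<open>\<phi>\<close> and
  \<open>d / \<phi>\<close> tend to infinity, so the number of fingerprints and the excess of the containers over
  half of the vertices are negligible.
\<close>
lemma regular_num_indep_sets_upper:
  fixes c :: real and N :: "nat set" and V :: "nat \<Rightarrow> 'a set"
  assumes c: "0 < c" "c \<le> 1 / 2"
    and pos: "\<And>n. n \<in> N \<Longrightarrow> 0 < n \<and> 0 < d n"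
    and d: "filterlim d at_top (along N)"
    and \<alpha>: "((\<lambda>n. real (\<alpha> n) / real n) \<longlongrightarrow> c) (along N)"
    and G: "\<And>n. n \<in> N \<Longrightarrow> nda_graph n (d n) (\<alpha> n) (V n) (E n)"
  shows "\<exists>\<epsilon>. (\<epsilon> \<longlongrightarrow> 0) (along N) \<and>
           (\<forall>n\<in>N. real (num_indep_sets (V n) (E n)) \<le> k_ind c powr (real n * (1 + \<epsilon> n)))"
proof -
  define s where "s = nat \<lfloor>1 / (2 * c)\<rfloor>"
  note k = ln_k_ind[OF c, folded s_def]
  define A where "A = zykov_coeff s"
  define B where "B = zykov_base s"
  have A0: "A > 0" and B1: "B > 1"
    unfolding A_def B_def by (rule zykov_coeff_pos zykov_base_gt_1)+
  have lnB: "ln B = ln (2 + real s) - ln (1 + real s)"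
    by (simp add: B_def zykov_base_def ln_div)
  have lnA: "ln A = ln (1 + real s) - real s * ln B"
    using B1 unfolding A_def zykov_coeff_def B_def[symmetric] by (simp add: ln_div ln_realpow)
  \<comment> \<open>Of the three terms of \<open>u n\<close>, the first accounts for the fingerprints, the others for the sets in one container.\<close>
  define f where "f x = ln (1 + 1 / sqrt x) + ln (sqrt x) / sqrt x" for x
  define g where "g x = x / (2 * x - sqrt x)" for x :: real
  define u where "u n = f (real (d n)) + real (\<alpha> n) / real n * ln A + g (real (d n)) * ln B" for n
  have dr: "filterlim (\<lambda>n. real (d n)) at_top (along N)"
    by (rule filterlim_compose[OF filterlim_real_sequentially d])
  have "(f \<longlongrightarrow> 0) at_top" unfolding f_def by real_asymp
  moreover have "(g \<longlongrightarrow> 1 / 2) at_top" unfolding g_def by real_asymp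
  ultimately have "(u \<longlongrightarrow> 0 + c * ln A + 1 / 2 * ln B) (along N)"
    unfolding u_def using dr \<alpha> by (intro tendsto_intros) (auto intro: filterlim_compose)
  also have "0 + c * ln A + 1 / 2 * ln B = ln (k_ind c)"
    unfolding k(1) lnA lnB by (simp add: algebra_simps)
  finally have u: "(u \<longlongrightarrow> ln (k_ind c)) (along N)" .
  have "((\<lambda>n. u n / ln (k_ind c) - 1) \<longlongrightarrow> ln (k_ind c) / ln (k_ind c) - 1) (along N)"
    using k(2) u by (intro tendsto_intros) auto
  then have lim: "((\<lambda>n. u n / ln (k_ind c) - 1) \<longlongrightarrow> 0) (along N)"
    using k(2) by simp
  have "real (num_indep_sets (V n) (E n)) \<le> k_ind c powr (real n * (1 + (u n / ln (k_ind c) - 1)))"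
    if n: "n \<in> N" for n
  proof -
    have sg: "simple_graph (V n) (E n)" and cV: "card (V n) = n"
      and reg: "regular_graph (d n) (V n) (E n)" and ind: "independence_number (V n) (E n) \<le> \<alpha> n"
      using G[OF n] by (auto simp: nda_graph_def)
    have fin: "finite (V n)" and n0: "0 < n" and d0: "1 \<le> d n"
      using sg pos[OF n] by (auto simp: simple_graph_def)
    have deg: "card (nbrs (V n) (E n) v) = d n" if "v \<in> V n" for v
    proof -
      have "nbrs (V n) (E n) v = {w \<in> V n. {v, w} \<in> E n}"
        using sg by (auto simp: nbrs_def simple_graph_def nsets_def)
      then show ?thesis using reg that by (simp add: regular_graph_def)
    qed
    have a: "card I \<le> \<alpha> n" if "I \<in> indep_sets_of (V n) (E n)" for I
      using ind that fin unfolding independence_number_def by (subst (asm) Max_le_iff) auto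
    define \<phi> where "\<phi> = sqrt (real (d n))"
    have \<phi>: "1 \<le> \<phi>" "\<phi> \<le> real (d n)"
      using d0 by (auto simp: \<phi>_def intro!: real_le_lsqrt self_le_power simp: power2_eq_square)
    have "real (num_indep_sets (V n) (E n)) \<le> (1 + 1 / \<phi>) ^ n * \<phi> powr (real n / \<phi>) *
         (A ^ \<alpha> n * B powr (real n * real (d n) / (2 * real (d n) - \<phi>)))"
      using num_indep_sets_regular_le[OF fin deg a \<phi>, of s] cV by (simp add: A_def B_def)
    also have "\<dots> = exp (real n * u n)"
    proof -
      have "(1 + 1 / \<phi>) ^ n = exp (real n * ln (1 + 1 / \<phi>))"
        using \<phi> by (simp add: exp_of_nat_mult add_pos_pos)
      moreover have "A ^ \<alpha> n = exp (real (\<alpha> n) * ln A)"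
        using A0 by (simp add: exp_of_nat_mult)
      moreover have "real n * u n = real n * ln (1 + 1 / \<phi>) + real n / \<phi> * ln \<phi> +
          (real (\<alpha> n) * ln A + real n * real (d n) / (2 * real (d n) - \<phi>) * ln B)"
        using n0 by (simp add: u_def f_def g_def \<phi>_def distrib_left)
      ultimately show ?thesis
        using \<phi> B1 by (simp add: powr_def exp_add)
    qed
    finally show ?thesis using powr_eq_exp_scaled[OF k(2)] by simp
  qed
  with lim show ?thesis by blast
qed

text \<open>
  On \<open>n = 2 * h\<close> vertices use \<open>q = \<lfloor>c n\<rfloor>\<close> cliques per side. The inequalities for \<open>s\<close> ensure
  \<open>s q \<le> h \<le> (s + 1) q\<close> for large \<open>n\<close>, so that the clique orders are indeed \<open>s\<close> and \<open>s + 1\<close>.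
\<close>
lemma regular_num_indep_sets_lower:
  fixes c :: real
  assumes c: "0 < c" "c \<le> 1 / 2"
  shows "\<exists>(N :: nat set) (d :: nat \<Rightarrow> nat) (\<alpha> :: nat \<Rightarrow> nat)
                (V :: nat \<Rightarrow> nat set) (E :: nat \<Rightarrow> nat set set).
           infinite N \<and>
           (\<forall>n\<in>N. 0 < n \<and> 0 < d n \<and> 0 < \<alpha> n) \<and>
           filterlim d at_top (along N) \<and>
           ((\<lambda>n. real (\<alpha> n) / real n) \<longlongrightarrow> c) (along N) \<and>
           Limsup (along N) (\<lambda>n. ereal (real (d n) / real n)) \<le> ereal (1 / 2) \<and>
           (\<forall>n\<in>N. nda_graph n (d n) (\<alpha> n) (V n) (E n)) \<and>
           (\<exists>\<epsilon> :: nat \<Rightarrow> real. (\<epsilon> \<longlongrightarrow> 0) (along N) \<and>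
              (\<forall>n\<in>N. real (num_indep_sets (V n) (E n)) \<ge> k_ind c powr (real n * (1 + \<epsilon> n))))"
proof -
  define s where "s = nat \<lfloor>1 / (2 * c)\<rfloor>"
  note s = floor_half_inverse[OF c, folded s_def]
  note k = ln_k_ind[OF c, folded s_def]
  define Q where "Q n = nat \<lfloor>c * real n\<rfloor>" for n
  have realQ: "real (Q n) = of_int \<lfloor>c * real n\<rfloor>" for n
    using c by (simp add: Q_def)
  have limQ: "((\<lambda>n. real (Q n) / real n) \<longlongrightarrow> c) sequentially"
    unfolding realQ using c(1) by real_asymp
  have "1 / (2 * (real s + 1)) < c"
    using s(3) by (simp add: field_simps)
  then have "eventually (\<lambda>n. 1 / (2 * (real s + 1)) < real (Q n) / real n) sequentially"
    by (rule order_tendstoD(1)[OF limQ])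
  then obtain m where m: "\<And>n. n \<ge> m \<Longrightarrow> 1 / (2 * (real s + 1)) < real (Q n) / real n"
    by (auto simp: eventually_sequentially)
  \<comment> \<open>The second entry forces \<open>Q n \<ge> 2\<close>, so that the pairs on opposite sides do not exceed \<open>Q n\<close>.\<close>
  define n\<^sub>0 where "n\<^sub>0 = max m (4 * Suc s)"
  define N where "N = {n. even n \<and> n \<ge> n\<^sub>0}"
  have N: "even n" "n \<ge> 4 * Suc s" "n \<le> 2 * (Suc s * Q n)" "2 * (s * Q n) \<le> n" if "n \<in> N" for n
  proof -
    show ev: "even n" and ge: "n \<ge> 4 * Suc s" using that by (auto simp: N_def n\<^sub>0_def)
    have "1 / (2 * (real s + 1)) < real (Q n) / real n"
      using that by (intro m) (auto simp: N_def n\<^sub>0_def)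
    then have "real n \<le> real (2 * (Suc s * Q n))"
      using ge by (simp add: field_simps)
    then show "n \<le> 2 * (Suc s * Q n)" by (simp only: of_nat_le_iff)
    have "real (Q n) \<le> c * real n" unfolding realQ by simp
    then have "2 * (real s * real (Q n)) \<le> 2 * (real s * (c * real n))"
      by (intro mult_left_mono) auto
    also have "\<dots> = 2 * (c * real s) * real n" by simp
    also have "\<dots> \<le> 1 * real n" using s(2) by (intro mult_right_mono) auto
    finally have "real (2 * (s * Q n)) \<le> real n" by simp
    then show "2 * (s * Q n) \<le> n" by (simp only: of_nat_le_iff)
  qed
  have Q2: "2 \<le> Q n" if "n \<in> N" for n
  proof -
    have "Suc s * 2 \<le> Suc s * Q n" using N(2,3)[OF that] by linarith
    then show ?thesis by (simp only: Suc_mult_le_cancel1)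
  qed
  have infN: "infinite N"
    unfolding infinite_nat_iff_unbounded_le
  proof
    fix m
    have "2 * (m + n\<^sub>0) \<ge> m" "2 * (m + n\<^sub>0) \<in> N" by (auto simp: N_def)
    then show "\<exists>n\<ge>m. n \<in> N" by blast
  qed
  define y where "y n = n div 2 - s * Q n" for n
  have y: "n div 2 = s * Q n + y n" "y n \<le> Q n" if "n \<in> N" for n
    using N[OF that] by (auto simp: y_def)
  define d where "d n = n div 2 + s - 1" for n
  define V where "V n = {..<n}" for n :: nat
  define E where "E n = two_sided_edges (n div 2) (Q n) (y n)" for n
  have graph: "nda_graph n (d n) (Q n) (V n) (E n)" if "n \<in> N" for n
    using nda_graph_two_sided[OF y[OF that] Q2[OF that]] N(1)[OF that]
    by (simp add: d_def V_def E_def)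
  have limQN: "((\<lambda>n. real (Q n) / real n) \<longlongrightarrow> c) (along N)"
    using limQ along_le by (rule tendsto_mono[rotated])
  have "filterlim d at_top sequentially"
    unfolding filterlim_at_top eventually_sequentially
  proof (intro allI exI impI)
    fix Z n :: nat assume "n \<ge> 2 * Z"
    then show "Z \<le> d n" using s(1) by (simp add: d_def)
  qed
  then have limd: "filterlim d at_top (along N)"
    using along_le by (rule filterlim_mono[OF _ order_refl])
  have "((\<lambda>n. 1 / 2 + (real s - 1) / real n) \<longlongrightarrow> 1 / 2) sequentially"
    by real_asymp
  then have "((\<lambda>n. 1 / 2 + (real s - 1) / real n) \<longlongrightarrow> 1 / 2) (along N)"
    using along_le by (rule tendsto_mono[rotated])
  moreover have "eventually (\<lambda>n. 1 / 2 + (real s - 1) / real n = real (d n) / real n) (along N)"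
  proof (rule eventually_in_along)
    fix n assume "n \<in> N"
    then have "real (d n) = real n / 2 + (real s - 1)" and "n > 0"
      using N[of n] s(1) by (auto simp: d_def real_of_nat_div)
    then show "1 / 2 + (real s - 1) / real n = real (d n) / real n"
      by (simp add: add_divide_distrib)
  qed
  ultimately have "((\<lambda>n. real (d n) / real n) \<longlongrightarrow> 1 / 2) (along N)"
    by (simp cong: tendsto_cong)
  then have "((\<lambda>n. ereal (real (d n) / real n)) \<longlongrightarrow> ereal (1 / 2)) (along N)"
    by (rule tendsto_ereal)
  then have limsup: "Limsup (along N) (\<lambda>n. ereal (real (d n) / real n)) = ereal (1 / 2)"
    by (rule lim_imp_Limsup[OF along_neq_bot[OF infN]])
  define u where "u n = ((real s + 1) * (real (Q n) / real n) - 1 / 2) * ln (1 + real s)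
      + (1 / 2 - real s * (real (Q n) / real n)) * ln (2 + real s)" for n
  have "(u \<longlongrightarrow> ((real s + 1) * c - 1 / 2) * ln (1 + real s) + (1 / 2 - real s * c) * ln (2 + real s)) (along N)"
    unfolding u_def by (intro tendsto_intros limQN)
  then have "(u \<longlongrightarrow> ln (k_ind c)) (along N)"
    unfolding k(1) by (simp add: mult.commute)
  then have "((\<lambda>n. u n / ln (k_ind c) - 1) \<longlongrightarrow> ln (k_ind c) / ln (k_ind c) - 1) (along N)"
    using k(2) by (intro tendsto_intros) auto
  then have lim: "((\<lambda>n. u n / ln (k_ind c) - 1) \<longlongrightarrow> 0) (along N)"
    using k(2) by simp
  have "real (num_indep_sets (V n) (E n)) \<ge> k_ind c powr (real n * (1 + (u n / ln (k_ind c) - 1)))"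
    if n: "n \<in> N" for n
  proof -
    have n0: "n > 0" using N(2)[OF n] by simp
    have ry: "real (y n) = real n / 2 - real s * real (Q n)"
    proof -
      have "real (n div 2) = real s * real (Q n) + real (y n)"
        using y(1)[OF n] by (metis of_nat_add of_nat_mult)
      moreover have "real n = 2 * real (n div 2)" using N(1)[OF n] by (simp add: real_of_nat_div)
      ultimately show ?thesis by linarith
    qed
    have "real n * u n = real (Q n - y n) * ln (1 + real s) + real (y n) * ln (2 + real s)"
      using n0 y(2)[OF n] by (simp add: u_def ry field_simps)
    then have "exp (real n * u n) = (1 + real s) ^ (Q n - y n) * (2 + real s) ^ y n"
      by (simp add: exp_add exp_of_nat_mult add_pos_nonneg)
    also have "\<dots> = real ((Suc s) ^ (Q n - y n) * (Suc (Suc s)) ^ y n)" by (simp add: add_ac)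
    also have "\<dots> \<le> real (num_indep_sets (V n) (E n))"
      using num_indep_sets_two_sided_ge[OF y[OF n]] Q2[OF n] N(1)[OF n] unfolding V_def E_def
      by (intro of_nat_mono) auto
    finally show ?thesis using powr_eq_exp_scaled[OF k(2)] by simp
  qed
  then have "\<exists>\<epsilon> :: nat \<Rightarrow> real. (\<epsilon> \<longlongrightarrow> 0) (along N) \<and>
      (\<forall>n\<in>N. real (num_indep_sets (V n) (E n)) \<ge> k_ind c powr (real n * (1 + \<epsilon> n)))"
    using lim by blast
  moreover have "\<forall>n\<in>N. 0 < n \<and> 0 < d n \<and> 0 < Q n"
    using N Q2 s(1) by (fastforce simp: d_def)
  ultimately show ?thesis
    using infN limd limQN limsup graph
    by (intro exI[of _ N] exI[of _ d] exI[of _ Q] exI[of _ V] exI[of _ E]) auto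
qed

theorem theorem1p1:
  fixes c :: real
  assumes "0 < c" and "c \<le> 1 / 2"
  shows "(\<forall>(N :: nat set) (d :: nat \<Rightarrow> nat) (\<alpha> :: nat \<Rightarrow> nat)
                (V :: nat \<Rightarrow> 'a set) (E :: nat \<Rightarrow> 'a set set).
           infinite N \<longrightarrow>
           (\<forall>n\<in>N. 0 < n \<and> 0 < d n \<and> 0 < \<alpha> n) \<longrightarrow>
           filterlim d at_top (along N) \<longrightarrow>
           ((\<lambda>n. real (\<alpha> n) / real n) \<longlongrightarrow> c) (along N) \<longrightarrow>
           (\<forall>n\<in>N. nda_graph n (d n) (\<alpha> n) (V n) (E n)) \<longrightarrow>
           (\<exists>\<epsilon> :: nat \<Rightarrow> real. (\<epsilon> \<longlongrightarrow> 0) (along N) \<and>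
              (\<forall>n\<in>N. real (num_indep_sets (V n) (E n)) \<le> k_ind c powr (real n * (1 + \<epsilon> n)))))
    \<and> (\<exists>(N :: nat set) (d :: nat \<Rightarrow> nat) (\<alpha> :: nat \<Rightarrow> nat)
                (V :: nat \<Rightarrow> nat set) (E :: nat \<Rightarrow> nat set set).
           infinite N \<and>
           (\<forall>n\<in>N. 0 < n \<and> 0 < d n \<and> 0 < \<alpha> n) \<and>
           filterlim d at_top (along N) \<and>
           ((\<lambda>n. real (\<alpha> n) / real n) \<longlongrightarrow> c) (along N) \<and>
           Limsup (along N) (\<lambda>n. ereal (real (d n) / real n)) \<le> ereal (1 / 2) \<and>
           (\<forall>n\<in>N. nda_graph n (d n) (\<alpha> n) (V n) (E n)) \<and>
           (\<exists>\<epsilon> :: nat \<Rightarrow> real. (\<epsilon> \<longlongrightarrow> 0) (along N) \<and>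
              (\<forall>n\<in>N. real (num_indep_sets (V n) (E n)) \<ge> k_ind c powr (real n * (1 + \<epsilon> n)))))"
proof (intro conjI allI impI)
  fix N :: "nat set" and d \<alpha> :: "nat \<Rightarrow> nat" and V :: "nat \<Rightarrow> 'a set" and E
  assume "\<forall>n\<in>N. 0 < n \<and> 0 < d n \<and> 0 < \<alpha> n" "filterlim d at_top (along N)"
    "((\<lambda>n. real (\<alpha> n) / real n) \<longlongrightarrow> c) (along N)"
    "\<forall>n\<in>N. nda_graph n (d n) (\<alpha> n) (V n) (E n)"
  then show "\<exists>\<epsilon> :: nat \<Rightarrow> real. (\<epsilon> \<longlongrightarrow> 0) (along N) \<and>
      (\<forall>n\<in>N. real (num_indep_sets (V n) (E n)) \<le> k_ind c powr (real n * (1 + \<epsilon> n)))"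
    by (intro regular_num_indep_sets_upper[OF assms, of N d \<alpha>]) auto
qed (rule regular_num_indep_sets_lower[OF assms])

end
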